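(* For every integer $n\geq 10$ there exists a maximum 8-cycle packing of $K_n$ which is not almost 2-perfect.
   Context: An 8-cycle packing of $K_n$ on an $n$-element vertex set $\mathcal{X}$ is a triple $(\mathcal{X},\mathcal{C},\mathcal{L})$ where $\mathcal{C}$ is a collection of pairwise edge-disjoint 8-cycles of $K_n$ and the leave $\mathcal{L}$ is the set of edges of $K_n$ lying in no cycle of $\mathcal{C}$. It is a maximum packing if $|\mathcal{L}|$ is as small as possible among all 8-cycle packings of $K_n$. For an 8-cycle $C$, an inside 8-cycle of $C$ is an 8-cycle on the same vertex set as $C$ sharing no edge with $C$. The packing is almost 2-perfect (A2P) if one can choose, for each $C\in\mathcal{C}$, an inside 8-cycle $C'$ of $C$ such that the chosen cycles $\mathcal{C}'$ are pairwise edge-disjoint and contain no edge of $\mathcal{L}$, i.e. $(\mathcal{X},\mathcal{C}',\mathcal{L})$ is again an 8-cycle packing with the same leave. *)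

theory Defs
  imports Main
begin

definition complete_edges :: "'a set \<Rightarrow> 'a set set" where
  "complete_edges X = {e. \<exists>u v. u \<in> X \<and> v \<in> X \<and> u \<noteq> v \<and> e = {u, v}}"

definition cycle_edges :: "'a list \<Rightarrow> 'a set set" where
  "cycle_edges vs = {{vs ! i, vs ! ((i + 1) mod length vs)} | i. i < length vs}"

definition is_8cycle :: "'a set \<Rightarrow> 'a set set \<Rightarrow> bool" where
  "is_8cycle X C \<longleftrightarrow> (\<exists>vs. length vs = 8 \<and> distinct vs \<and> set vs \<subseteq> X \<and> C = cycle_edges vs)"

definition cycle_verts :: "'a set set \<Rightarrow> 'a set" where
  "cycle_verts C = \<Union>C"

definition packing8 :: "'a set \<Rightarrow> 'a set set set \<Rightarrow> 'a set set \<Rightarrow> bool" where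
  "packing8 X Cs L \<longleftrightarrow>
     (\<forall>C\<in>Cs. is_8cycle X C) \<and>
     (\<forall>C1\<in>Cs. \<forall>C2\<in>Cs. C1 \<noteq> C2 \<longrightarrow> C1 \<inter> C2 = {}) \<and>
     L = complete_edges X - \<Union>Cs"

definition max_packing8 :: "'a set \<Rightarrow> 'a set set set \<Rightarrow> 'a set set \<Rightarrow> bool" where
  "max_packing8 X Cs L \<longleftrightarrow> packing8 X Cs L \<and>
     (\<forall>Cs' L'. packing8 X Cs' L' \<longrightarrow> card L \<le> card L')"

definition inside8 :: "'a set \<Rightarrow> 'a set set \<Rightarrow> 'a set set \<Rightarrow> bool" where
  "inside8 X C' C \<longleftrightarrow> is_8cycle X C' \<and> cycle_verts C' = cycle_verts C \<and> C' \<inter> C = {}"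

definition almost_2_perfect8 :: "'a set \<Rightarrow> 'a set set set \<Rightarrow> 'a set set \<Rightarrow> bool" where
  "almost_2_perfect8 X Cs L \<longleftrightarrow>
     (\<exists>f. (\<forall>C\<in>Cs. inside8 X (f C) C) \<and>
          (\<forall>C1\<in>Cs. \<forall>C2\<in>Cs. C1 \<noteq> C2 \<longrightarrow> f C1 \<inter> f C2 = {}) \<and>
          (\<forall>C\<in>Cs. f C \<inter> L = {}))"

end

theory Submission
  imports Defs
begin

text \<open>
  \<^emph>\<open>Maximality.\<close> In a packing of the complete graph on \<open>n\<close> vertices every vertex has the same
  parity in the leave as \<open>n - 1\<close>, and the size of the leave is determined modulo 8. Hence for even
  \<open>n\<close> the leave has at least \<open>n / 2\<close> edges, and for odd \<open>n\<close> it is empty or has at least 3 edges; a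
  packing whose leave is within the next period of 8 is maximum.

  \<^emph>\<open>Failure of 2-perfection.\<close> The inside cycles avoid the leave, so by counting they cover exactly
  the edges covered by the packing. If every cycle through both \<open>u\<close> and \<open>v\<close> contains the edge
  \<open>uv\<close>, no inside cycle can contain it. Moreover, a packing is not almost 2-perfect as soon as it
  extends, with its leave, such a packing on a subset of the vertices.

  \<^emph>\<open>Recursion.\<close> A complete bipartite graph with parts of even size at least 4, one of them
  divisible by 4, decomposes into 8-cycles. So one passes from \<open>n\<close> to \<open>n + 8\<close> for even \<open>n\<close> by adding a
  packing of the complete graph on 8 vertices with a 1-factor as leave, and from \<open>n\<close> to \<open>n + 16\<close> for odd
  \<open>n\<close> by adding a decomposition of the complete graph on 17 vertices through one old vertex. This
  leaves finitely many orders, of which only 10 admits no edge \<open>uv\<close> as above.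
\<close>

subsection \<open>Eight-cycles\<close>

lemma length_8E:
  assumes "length vs = 8"
  obtains a b c d e f g h where "vs = [a, b, c, d, e, f, g, h]"
  using assms by (auto simp: numeral_eq_Suc length_Suc_conv)

lemma cycle_edges_8:
  "cycle_edges [a, b, c, d, e, f, g, h] =
    {{a, b}, {b, c}, {c, d}, {d, e}, {e, f}, {f, g}, {g, h}, {h, a}}"
proof -
  have "{..<8::nat} = {0, 1, 2, 3, 4, 5, 6, 7}" by auto
  moreover have "cycle_edges [a, b, c, d, e, f, g, h] =
      (\<lambda>i. {[a, b, c, d, e, f, g, h] ! i, [a, b, c, d, e, f, g, h] ! ((i + 1) mod 8)}) ` {..<8}"
    unfolding cycle_edges_def by auto
  ultimately show ?thesis by (simp add: insert_commute)
qed

lemma is_8cycleE: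
  assumes "is_8cycle X C"
  obtains a b c d e f g h where
    "distinct [a, b, c, d, e, f, g, h]" "{a, b, c, d, e, f, g, h} \<subseteq> X"
    "C = {{a, b}, {b, c}, {c, d}, {d, e}, {e, f}, {f, g}, {g, h}, {h, a}}"
proof -
  from assms obtain vs where vs: "length vs = 8" "distinct vs" "set vs \<subseteq> X" "C = cycle_edges vs"
    unfolding is_8cycle_def by blast
  obtain a b c d e f g h where "vs = [a, b, c, d, e, f, g, h]"
    using length_8E[OF vs(1)] .
  with vs show thesis by (intro that[of a b c d e f g h]) (auto simp: cycle_edges_8)
qed

lemma Union_cycle_edges: "length vs = 8 \<Longrightarrow> \<Union> (cycle_edges vs) = set vs"
  by (erule length_8E) (auto simp: cycle_edges_8)

text \<open>The ambient set only bounds the vertices, so a cycle passes from one ambient set to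
  another by comparing vertex sets.\<close>

lemma is_8cycle_iff: "is_8cycle X C \<longleftrightarrow> is_8cycle UNIV C \<and> \<Union> C \<subseteq> X"
  unfolding is_8cycle_def using Union_cycle_edges by auto

text \<open>Listing the eight edges without repetition turns cardinalities of sets of cycle edges
  into lengths of lists.\<close>

lemma is_8cycle_listE:
  assumes "is_8cycle X C"
  obtains a b c d e f g h where
    "distinct [a, b, c, d, e, f, g, h]"
    "C = set [{a, b}, {b, c}, {c, d}, {d, e}, {e, f}, {f, g}, {g, h}, {h, a}]"
    "distinct [{a, b}, {b, c}, {c, d}, {d, e}, {e, f}, {f, g}, {g, h}, {h, a}]"
proof -
  from assms obtain a b c d e f g h where
    *: "distinct [a, b, c, d, e, f, g, h]"
    "C = {{a, b}, {b, c}, {c, d}, {d, e}, {e, f}, {f, g}, {g, h}, {h, a}}"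
    by (rule is_8cycleE)
  from *(1) have "distinct [{a, b}, {b, c}, {c, d}, {d, e}, {e, f}, {f, g}, {g, h}, {h, a}]"
    by (auto simp: doubleton_eq_iff)
  then show thesis using * by (intro that[of a b c d e f g h]) simp_all
qed

lemma card_8cycle: "is_8cycle X C \<Longrightarrow> card C = 8"
  by (erule is_8cycle_listE) (simp only: distinct_card, simp)

lemma finite_8cycle: "is_8cycle X C \<Longrightarrow> finite C"
  by (erule is_8cycleE) simp

lemma degree_8cycle:
  assumes "is_8cycle X C" "v \<in> \<Union> C"
  shows "card {e \<in> C. v \<in> e} = 2"
proof -
  from assms(1) obtain a b c d e f g h where
    d: "distinct [a, b, c, d, e, f, g, h]" and
    C: "C = set [{a, b}, {b, c}, {c, d}, {d, e}, {e, f}, {f, g}, {g, h}, {h, a}]" and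
    dE: "distinct [{a, b}, {b, c}, {c, d}, {d, e}, {e, f}, {f, g}, {g, h}, {h, a}]"
    by (rule is_8cycle_listE)
  let ?E = "[{a, b}, {b, c}, {c, d}, {d, e}, {e, f}, {f, g}, {g, h}, {h, a}]"
  \<comment> \<open>The degree becomes the length of a filtered list, which is evaluated for each of
    the eight positions of \<open>v\<close>.\<close>
  have "card {e \<in> C. v \<in> e} = card (set (filter (\<lambda>e. v \<in> e) ?E))"
    unfolding C by (rule arg_cong[where f = card]) (rule set_filter[symmetric])
  also have "\<dots> = length (filter (\<lambda>e. v \<in> e) ?E)"
    by (intro distinct_card distinct_filter dE)
  also have "\<dots> = 2"
  proof -
    have "v = a \<or> v = b \<or> v = c \<or> v = d \<or> v = e \<or> v = f \<or> v = g \<or> v = h"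
      using assms(2) C by auto
    then show ?thesis using d by (elim disjE) auto
  qed
  finally show ?thesis .
qed

lemma doubleton_complete_edges: "{u, v} \<in> complete_edges X \<longleftrightarrow> u \<in> X \<and> v \<in> X \<and> u \<noteq> v"
  unfolding complete_edges_def by (auto simp: doubleton_eq_iff)

lemma is_8cycle_subset_complete:
  assumes "is_8cycle X C" shows "C \<subseteq> complete_edges X"
proof -
  from assms obtain a b c d e f g h where
    "distinct [a, b, c, d, e, f, g, h]" "{a, b, c, d, e, f, g, h} \<subseteq> X"
    "C = {{a, b}, {b, c}, {c, d}, {d, e}, {e, f}, {f, g}, {g, h}, {h, a}}"
    by (rule is_8cycleE)
  then show ?thesis by (auto simp: doubleton_complete_edges)
qed

lemma is_8cycle_image:
  assumes "is_8cycle X C" "inj_on g X"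
  shows "is_8cycle (g ` X) ((`) g ` C)"
proof -
  from assms obtain vs where vs: "length vs = 8" "distinct vs" "set vs \<subseteq> X" "C = cycle_edges vs"
    unfolding is_8cycle_def by blast
  have "(`) g ` C = cycle_edges (map g vs)"
    using vs(1,4) by (elim length_8E) (simp add: cycle_edges_8)
  moreover have "distinct (map g vs)"
    using vs assms(2) by (simp add: distinct_map inj_on_subset)
  ultimately show ?thesis
    unfolding is_8cycle_def using vs by (intro exI[of _ "map g vs"]) auto
qed

subsection \<open>Complete graphs and counting in packings\<close>

lemma complete_edges_eq: "complete_edges X = {e. e \<subseteq> X \<and> card e = 2}"
  unfolding complete_edges_def by (auto simp: card_2_iff)

lemma complete_edges_mono: "X \<subseteq> Y \<Longrightarrow> complete_edges X \<subseteq> complete_edges Y"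
  by (auto simp: complete_edges_eq)

lemma finite_complete_edges: "finite X \<Longrightarrow> finite (complete_edges X)"
  by (rule finite_subset[of _ "Pow X"]) (auto simp: complete_edges_eq)

lemma card_complete_edges: "finite X \<Longrightarrow> card (complete_edges X) = card X choose 2"
  by (simp add: complete_edges_eq n_subsets)

lemma degree_complete:
  assumes "finite X" "v \<in> X"
  shows "card {e \<in> complete_edges X. v \<in> e} = card X - 1"
proof -
  have "{e \<in> complete_edges X. v \<in> e} = (\<lambda>w. {v, w}) ` (X - {v})"
    using assms(2) unfolding complete_edges_def by auto
  moreover have "inj_on (\<lambda>w. {v, w}) (X - {v})"
    by (auto simp: inj_on_def doubleton_eq_iff)
  ultimately show ?thesis using assms by (simp add: card_image)
qed

section \<open>Size and parity of the leave\<close>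

context
  fixes X :: "'a set" and Cs L
  assumes X: "finite X" and P: "packing8 X Cs L"
begin

lemma packing_cycles: "C \<in> Cs \<Longrightarrow> is_8cycle X C"
  using P by (simp add: packing8_def)

lemma packing_disjoint: "C1 \<in> Cs \<Longrightarrow> C2 \<in> Cs \<Longrightarrow> C1 \<noteq> C2 \<Longrightarrow> C1 \<inter> C2 = {}"
  using P by (simp add: packing8_def)

lemma packing_Union_subset: "\<Union> Cs \<subseteq> complete_edges X"
  using packing_cycles is_8cycle_subset_complete by blast

lemma packing_leave: "L = complete_edges X - \<Union> Cs"
  using P by (simp add: packing8_def)

lemma packing_finite: "finite Cs"
  by (rule finite_subset[of _ "Pow (complete_edges X)"])
    (use packing_Union_subset finite_complete_edges[OF X] in auto)

lemma packing_finite_leave: "finite L"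
  using finite_complete_edges[OF X] by (simp add: packing_leave)

lemma packing_card_Union: "card (\<Union> Cs) = 8 * card Cs"
proof -
  have "card (\<Union> Cs) = (\<Sum>C\<in>Cs. card C)"
  proof (rule card_Union_disjoint)
    show "pairwise disjnt Cs" using packing_disjoint by (auto simp: pairwise_def disjnt_def)
    show "finite C" if "C \<in> Cs" for C using that packing_cycles finite_8cycle by blast
  qed
  also have "\<dots> = (\<Sum>C\<in>Cs. 8)" using packing_cycles card_8cycle by (intro sum.cong) blast+
  finally show ?thesis by simp
qed

text \<open>Each cycle takes 8 edges, so any two leaves on the same vertex set differ in size by a
  multiple of 8.\<close>

lemma packing_card_leave: "card L + 8 * card Cs = card X choose 2"
proof -
  have "card L = card (complete_edges X) - card (\<Union> Cs)"
    unfolding packing_leave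
    by (rule card_Diff_subset)
      (use packing_Union_subset finite_complete_edges[OF X] in \<open>auto intro: finite_subset\<close>)
  moreover have "card (\<Union> Cs) \<le> card (complete_edges X)"
    by (intro card_mono finite_complete_edges X packing_Union_subset)
  ultimately show ?thesis by (simp add: packing_card_Union card_complete_edges X)
qed

text \<open>A cycle takes 0 or 2 edges at \<open>v\<close>, so the degree of \<open>v\<close> in the
  leave has the parity of its degree \<open>card X - 1\<close> in the complete graph.\<close>

lemma packing_degree_leave:
  assumes v: "v \<in> X"
  shows "even (card {e \<in> L. v \<in> e}) \<longleftrightarrow> odd (card X)"
proof -
  let ?D = "\<lambda>S. {e \<in> S. v \<in> e}"
  have fin: "finite (?D S)" if "S \<subseteq> complete_edges X" for S
    using that finite_complete_edges[OF X] by (auto intro: finite_subset)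
  have "?D (complete_edges X) = ?D L \<union> ?D (\<Union> Cs)" "?D L \<inter> ?D (\<Union> Cs) = {}"
    using packing_leave packing_Union_subset by auto
  moreover have "finite (?D L)" "finite (?D (\<Union> Cs))"
    using fin[of L] fin[of "\<Union> Cs"] packing_leave packing_Union_subset by blast+
  ultimately have 1: "card X - 1 = card (?D L) + card (?D (\<Union> Cs))"
    using degree_complete[OF X v] by (simp add: card_Un_disjoint)
  have "card (\<Union> (?D ` Cs)) = (\<Sum>C\<in>Cs. card (?D C))"
  proof (rule card_UN_disjoint)
    show "\<forall>C\<in>Cs. finite (?D C)" using fin packing_Union_subset by blast
  qed (use packing_finite packing_disjoint in auto)
  moreover have "even (card (?D C))" if "C \<in> Cs" for C
  proof (cases "v \<in> \<Union> C")
    case True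
    then show ?thesis using degree_8cycle[OF packing_cycles[OF that]] by simp
  next
    case False
    then have "?D C = {}" by auto
    then show ?thesis by (metis card.empty even_zero)
  qed
  moreover have "?D (\<Union> Cs) = \<Union> (?D ` Cs)" by auto
  ultimately have 2: "even (card (?D (\<Union> Cs)))" by (simp add: dvd_sum)
  \<comment> \<open>Excludes truncation in \<open>card X - 1\<close>, so that its parity is opposite
    to that of \<open>card X\<close>.\<close>
  have "card X > 0" using v X by (auto simp: card_gt_0_iff)
  with 1 2 show ?thesis by presburger
qed

text \<open>Every vertex has odd, hence positive, degree in the leave. So the leave edges cover
  \<open>X\<close>, two vertices at a time.\<close>

lemma packing_leave_even:
  assumes "even (card X)"
  shows "card X \<le> 2 * card L"
proof -
  have "v \<in> \<Union> L" if "v \<in> X" for v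
  proof (rule ccontr)
    assume "v \<notin> \<Union> L"
    then have "{e \<in> L. v \<in> e} = {}" by auto
    then show False using packing_degree_leave[OF that] assms by (metis card.empty even_zero)
  qed
  then have "X \<subseteq> (\<Union>e\<in>L. e)" by auto
  moreover have fin: "finite e" "card e = 2" if "e \<in> L" for e
    using that X by (auto simp: packing_leave complete_edges_eq intro: finite_subset)
  ultimately have "card X \<le> card (\<Union>e\<in>L. e)"
    using packing_finite_leave by (intro card_mono) auto
  also have "\<dots> \<le> (\<Sum>e\<in>L. card e)" by (rule card_UN_le[OF packing_finite_leave])
  also have "\<dots> = 2 * card L" by (simp add: fin)
  finally show ?thesis .
qed

text \<open>All leave degrees are even, so no leave edge can end alone: each end of an edge
  \<open>{u, v}\<close> has a second leave edge, and these three edges are distinct.\<close>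

lemma packing_leave_odd:
  assumes "odd (card X)" "L \<noteq> {}"
  shows "card L \<ge> 3"
proof -
  have other: "\<exists>w. {u, w} \<in> L \<and> w \<noteq> v" if "{u, v} \<in> L" for u v
  proof (rule ccontr)
    assume no: "\<not> ?thesis"
    have "u \<in> X" using that packing_leave by (auto simp: complete_edges_eq)
    have "e = {u, v}" if e: "e \<in> L" "u \<in> e" for e
    proof -
      have "e \<in> complete_edges X" using e packing_leave by blast
      then obtain w where w: "e = {u, w}"
        using e unfolding complete_edges_def by blast
      then have "w = v" using no e by blast
      then show ?thesis using w by simp
    qed
    then have "{e \<in> L. u \<in> e} = {{u, v}}" using that by blast
    then show False using packing_degree_leave[OF \<open>u \<in> X\<close>] assms(1) by simp
  qed
  obtain u v where uv: "{u, v} \<in> L" "u \<noteq> v"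
    using assms(2) packing_leave unfolding complete_edges_def by blast
  obtain w where w: "{u, w} \<in> L" "w \<noteq> v" using other[OF uv(1)] by blast
  obtain x where x: "{v, x} \<in> L" "x \<noteq> u" using other[of v u] uv by (auto simp: insert_commute)
  have "card {{u, v}, {u, w}, {v, x}} = 3"
    using uv w x by (auto simp: card_insert_if doubleton_eq_iff)
  then show ?thesis using card_mono[OF packing_finite_leave, of "{{u, v}, {u, w}, {v, x}}"] uv w x by simp
qed

end

text \<open>A smaller leave would be smaller by at least 8. For even order this falls below half the
  order. For odd order it leaves at most 2 edges (10 = 3 + 8 - 1), so the smaller leave would have
  to be empty.\<close>

lemma max_packing8I:
  assumes X: "finite X" and P: "packing8 X Cs L"
    and ev: "even (card X) \<Longrightarrow> card L < card X div 2 + 8"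
    and od: "odd (card X) \<Longrightarrow> card L \<le> 10 \<and> card L \<noteq> 8"
  shows "max_packing8 X Cs L"
  unfolding max_packing8_def
proof (intro conjI allI impI P)
  fix Cs' L' assume P': "packing8 X Cs' L'"
  show "card L \<le> card L'"
  proof (rule ccontr)
    assume "\<not> card L \<le> card L'"
    moreover have "card L + 8 * card Cs = card L' + 8 * card Cs'"
      using packing_card_leave[OF X P] packing_card_leave[OF X P'] by simp
    ultimately have le: "card L' + 8 \<le> card L" by presburger
    show False
    proof (cases "even (card X)")
      case True
      then show False using ev le packing_leave_even[OF X P'] by linarith
    next
      case False
      \<comment> \<open>If \<open>L'\<close> were empty, \<open>card L\<close> would be a multiple
        of 8 between 8 and 10, hence 8, which is excluded.\<close>
      then have "L' \<noteq> {}" using od le \<open>card L + 8 * card Cs = _\<close>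
        by (cases "card L = 8") (auto, presburger)
      then show False using od le packing_leave_odd[OF X P' False] False by linarith
    qed
  qed
qed

subsection \<open>Glueing packings\<close>

definition biclique :: "'a set \<Rightarrow> 'a set \<Rightarrow> 'a set set" where
  "biclique A B = {{a, b} | a b. a \<in> A \<and> b \<in> B}"

text \<open>With \<open>UNIV\<close> as ambient set the property depends on the edge set alone, and
  disjoint edge sets can be joined without tracking vertices.\<close>

definition decomposable :: "'a set set \<Rightarrow> bool" where
  "decomposable E \<longleftrightarrow> (\<exists>Bs. (\<forall>C\<in>Bs. is_8cycle UNIV C) \<and>
     (\<forall>C1\<in>Bs. \<forall>C2\<in>Bs. C1 \<noteq> C2 \<longrightarrow> C1 \<inter> C2 = {}) \<and> \<Union> Bs = E)"

lemma decomposableE: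
  assumes "decomposable E"
  obtains Bs where "\<forall>C\<in>Bs. is_8cycle UNIV C" "\<Union> Bs = E"
    "\<forall>C1\<in>Bs. \<forall>C2\<in>Bs. C1 \<noteq> C2 \<longrightarrow> C1 \<inter> C2 = {}"
  using assms unfolding decomposable_def by (elim exE conjE) (rule that)

lemma decomposable_Un:
  assumes "decomposable E" "decomposable F" "E \<inter> F = {}"
  shows "decomposable (E \<union> F)"
proof -
  obtain Bs where Bs: "\<forall>C\<in>Bs. is_8cycle UNIV C" "\<Union> Bs = E"
     "\<forall>C1\<in>Bs. \<forall>C2\<in>Bs. C1 \<noteq> C2 \<longrightarrow> C1 \<inter> C2 = {}"
    by (rule decomposableE[OF assms(1)])
  obtain Ds where Ds: "\<forall>C\<in>Ds. is_8cycle UNIV C" "\<Union> Ds = F"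
     "\<forall>C1\<in>Ds. \<forall>C2\<in>Ds. C1 \<noteq> C2 \<longrightarrow> C1 \<inter> C2 = {}"
    by (rule decomposableE[OF assms(2)])
  have "C1 \<inter> C2 = {}" if "C1 \<in> Bs" "C2 \<in> Ds" for C1 C2
    using that Bs(2) Ds(2) assms(3) by blast
  then have "\<forall>C1 \<in> Bs \<union> Ds. \<forall>C2 \<in> Bs \<union> Ds. C1 \<noteq> C2 \<longrightarrow> C1 \<inter> C2 = {}"
    using Bs(3) Ds(3) by (metis Int_commute Un_iff)
  then show ?thesis unfolding decomposable_def
    using Bs(1,2) Ds(1,2) by (intro exI[of _ "Bs \<union> Ds"]) blast
qed

lemma decomposable_cycle:
  "length vs = 8 \<Longrightarrow> distinct vs \<Longrightarrow> decomposable (cycle_edges vs)"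
  unfolding decomposable_def is_8cycle_def by (intro exI[of _ "{cycle_edges vs}"]) auto

lemma biclique_commute: "biclique A B = biclique B A"
  unfolding biclique_def by (auto simp: insert_commute)

lemma biclique_Un: "biclique (A \<union> A') B = biclique A B \<union> biclique A' B"
  unfolding biclique_def by blast

text \<open>Edges are unordered, so disjointness of \<open>A\<close> and \<open>A'\<close> would not
  suffice: if both met \<open>B\<close>, an edge could be read in two ways.\<close>

lemma biclique_disjoint:
  assumes "A \<inter> A' = {}" "A \<inter> B = {}" "A' \<inter> B = {}"
  shows "biclique A B \<inter> biclique A' B = {}"
  using assms unfolding biclique_def by (auto simp: doubleton_eq_iff)

lemma decomposable_biclique_Un:
  assumes "decomposable (biclique A B)" "decomposable (biclique A' B)"
    and "A \<inter> A' = {}" "(A \<union> A') \<inter> B = {}"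
  shows "decomposable (biclique (A \<union> A') B)"
  unfolding biclique_Un using assms
  by (intro decomposable_Un biclique_disjoint) auto

lemma biclique_insert: "biclique (insert a A) B = (\<lambda>b. {a, b}) ` B \<union> biclique A B"
  unfolding biclique_def by blast

lemma biclique_empty: "biclique {} B = {}"
  unfolding biclique_def by blast

text \<open>Injectivity on the vertices of \<open>E\<close> carries over to its edges, so images of
  disjoint cycles stay disjoint.\<close>

lemma decomposable_image:
  assumes "decomposable E" "inj_on g (\<Union> E)"
  shows "decomposable ((`) g ` E)"
proof -
  obtain Bs where Bs: "\<forall>C\<in>Bs. is_8cycle UNIV C" "\<Union> Bs = E"
     "\<forall>C1\<in>Bs. \<forall>C2\<in>Bs. C1 \<noteq> C2 \<longrightarrow> C1 \<inter> C2 = {}"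
    by (rule decomposableE[OF assms(1)])
  have inj: "inj_on ((`) g) E"
    by (rule inj_on_subset[OF inj_on_image_Pow[OF assms(2)]]) auto
  let ?G = "(`) ((`) g)"
  have "is_8cycle UNIV (?G C)" if "C \<in> Bs" for C
  proof -
    have "\<Union> C \<subseteq> \<Union> E" using Bs(2) that by blast
    then have "is_8cycle (\<Union> E) C" using Bs(1) that is_8cycle_iff by blast
    then show ?thesis using is_8cycle_image[OF _ assms(2)] is_8cycle_iff by blast
  qed
  moreover have "?G C1 \<inter> ?G C2 = {}" if "C1 \<in> Bs" "C2 \<in> Bs" "?G C1 \<noteq> ?G C2" for C1 C2
  proof -
    have "?G C1 \<inter> ?G C2 = ?G (C1 \<inter> C2)"
      using that Bs(2) by (intro inj_on_image_Int[OF inj, symmetric]) auto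
    moreover have "C1 \<inter> C2 = {}" using that Bs(3) by metis
    ultimately show ?thesis by simp
  qed
  moreover have "\<Union> (?G ` Bs) = (`) g ` E" using Bs(2) by auto
  ultimately show ?thesis
    unfolding decomposable_def by (intro exI[of _ "?G ` Bs"]) auto
qed

lemma biclique_image: "biclique (g ` A) (g ` B) = (`) g ` biclique A B"
proof (intro subset_antisym subsetI)
  fix e assume "e \<in> biclique (g ` A) (g ` B)"
  then obtain a b where "a \<in> A" "b \<in> B" "e = g ` {a, b}" unfolding biclique_def by auto
  then show "e \<in> (`) g ` biclique A B" unfolding biclique_def by blast
qed (auto simp: biclique_def)

lemma decomposable_biclique_4_4: "decomposable (biclique {0, 1, 2, 3} {4, 5, 6, 7::nat})"
proof -
  \<comment> \<open>Two Hamiltonian cycles share out the 16 edges.\<close>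
  let ?C = "cycle_edges [0, 4, 1, 5, 2, 6, 3, 7::nat]" and ?D = "cycle_edges [0, 5, 3, 4, 2, 7, 1, 6::nat]"
  have "?C \<inter> ?D = {}"
    by (simp add: cycle_edges_8 doubleton_eq_iff)
  then have "decomposable (?C \<union> ?D)"
    by (intro decomposable_Un decomposable_cycle) simp_all
  also have "?C \<union> ?D = biclique {0, 1, 2, 3} {4, 5, 6, 7}"
    by (intro subset_antisym) (simp_all add: cycle_edges_8 biclique_insert biclique_empty doubleton_eq_iff)
  finally show ?thesis .
qed

lemma decomposable_biclique_6_4: "decomposable (biclique {0, 1, 2, 3, 4, 5} {6, 7, 8, 9::nat})"
proof -
  \<comment> \<open>Three cycles share out the 24 edges. Each passes through all of 6, 7, 8, 9 and
    four of the other six vertices; each of these six lies on two of the cycles.\<close>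
  let ?C = "cycle_edges [3, 8, 2, 7, 4, 6, 5, 9::nat]" and ?D = "cycle_edges [0, 7, 3, 6, 1, 8, 4, 9::nat]"
    and ?F = "cycle_edges [1, 9, 2, 6, 0, 8, 5, 7::nat]"
  have "?C \<inter> (?D \<union> ?F) = {}" "?D \<inter> ?F = {}"
    by (simp_all add: cycle_edges_8 doubleton_eq_iff)
  then have "decomposable (?C \<union> (?D \<union> ?F))"
    by (intro decomposable_Un decomposable_cycle) simp_all
  also have "?C \<union> (?D \<union> ?F) = biclique {0, 1, 2, 3, 4, 5} {6, 7, 8, 9}"
    by (intro subset_antisym) (simp_all add: cycle_edges_8 biclique_insert biclique_empty doubleton_eq_iff)
  finally show ?thesis .
qed

text \<open>The two explicit decompositions are transported along the map sending a position to the
  entry of \<open>as @ bs\<close>, which is injective by distinctness.\<close>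

lemma decomposable_biclique_lists:
  assumes "length as = 4 \<or> length as = 6" "length bs = 4" "distinct (as @ bs)"
  shows "decomposable (biclique (set as) (set bs))"
proof -
  let ?m = "length as" and ?g = "(!) (as @ bs)"
  have sets: "{0, 1, 2, 3} = {..<4::nat}" "{4, 5, 6, 7} = {4..<8::nat}"
    "{0, 1, 2, 3, 4, 5} = {..<6::nat}" "{6, 7, 8, 9} = {6..<10::nat}"
    by auto
  have "decomposable (biclique {..<4} {4..<8::nat})" "decomposable (biclique {..<6} {6..<10::nat})"
    using decomposable_biclique_4_4 decomposable_biclique_6_4 by (simp_all only: sets)
  then have "decomposable (biclique {..<?m} {?m..<?m + 4})"
    using assms(1) by (elim disjE) simp_all
  moreover have "inj_on ?g {..<?m + 4}"
    using assms by (intro inj_on_nth) auto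
  then have "inj_on ?g (\<Union> (biclique {..<?m} {?m..<?m + 4}))"
    by (rule inj_on_subset) (auto simp: biclique_def)
  ultimately have "decomposable (biclique (?g ` {..<?m}) (?g ` {?m..<?m + 4}))"
    unfolding biclique_image by (rule decomposable_image)
  moreover have nth: "(!) xs ` {..<length xs} = set xs" for xs :: "'a list"
    by (auto simp: set_conv_nth)
  have "?g ` {..<?m} = (!) as ` {..<?m}"
    by (intro image_cong) (simp_all add: nth_append)
  moreover have "?g ` {?m..<?m + 4} = (!) bs ` {..<4}"
  proof -
    have "{?m..<?m + 4} = (+) ?m ` {..<4}"
      by (simp add: lessThan_atLeast0 add.commute)
    then have "?g ` {?m..<?m + 4} = (\<lambda>i. ?g (?m + i)) ` {..<4}"
      by (simp only: image_image)
    also have "\<dots> = (!) bs ` {..<4}"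
      by (intro image_cong) (simp_all add: nth_append)
    finally show ?thesis .
  qed
  ultimately show ?thesis using nth[of as] nth[of bs] assms(2) by simp
qed

text \<open>Blocks of 4 vertices are split off \<open>A\<close> until 4 or 6 remain, the two sizes
  solved explicitly.\<close>

lemma decomposable_biclique_even_4:
  assumes "finite A" "even (card A)" "card A \<ge> 4" "card B = 4" "A \<inter> B = {}"
  shows "decomposable (biclique A B)"
  using assms
proof (induction "card A" arbitrary: A rule: less_induct)
  case less
  from \<open>card B = 4\<close> obtain bs where bs: "B = set bs" "distinct bs" "length bs = 4"
    by (metis card.infinite distinct_card finite_distinct_list zero_neq_numeral)
  obtain as where as: "A = set as" "distinct as" "length as = card A"
    using \<open>finite A\<close> by (metis distinct_card finite_distinct_list)
  consider "card A = 4" | "card A = 6" | "card A \<ge> 8"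
    using less.prems(2,3) by (cases "card A = 5"; cases "card A = 7"; force)
  then show ?case
  proof cases
    case 1
    then show ?thesis using decomposable_biclique_lists[of as bs] as bs less.prems(5) by auto
  next
    case 2
    then show ?thesis using decomposable_biclique_lists[of as bs] as bs less.prems(5) by auto
  next
    case 3
    then obtain A' where A': "A' \<subseteq> A" "card A' = 4" "finite A'"
      using obtain_subset_with_card_n[of 4 A] less.prems(3) by blast
    have c: "card (A - A') = card A - 4" using A' by (simp add: card_Diff_subset)
    have "decomposable (biclique A' B)"
      using A' 3 less.prems by (intro less.hyps) auto
    moreover have "decomposable (biclique (A - A') B)"
      using c 3 less.prems by (intro less.hyps) auto
    ultimately have "decomposable (biclique (A' \<union> (A - A')) B)"
      using A' less.prems(5) by (intro decomposable_biclique_Un) auto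
    moreover have "A' \<union> (A - A') = A" using A' by auto
    ultimately show ?thesis by simp
  qed
qed

text \<open>\<open>B\<close> is cut into blocks of size 4; each block against all of
  \<open>A\<close> is the previous case with the sides exchanged.\<close>

lemma decomposable_biclique:
  assumes "finite A" "even (card A)" "card A \<ge> 4" "finite B" "4 dvd card B" "A \<inter> B = {}"
  shows "decomposable (biclique A B)"
  using assms(4-6)
proof (induction "card B" arbitrary: B rule: less_induct)
  case less
  show ?case
  proof (cases "B = {}")
    case True
    then show ?thesis by (auto simp: decomposable_def biclique_def)
  next
    case False
    then have "card B \<ge> 4" using less.prems by (simp add: dvd_imp_le card_gt_0_iff)
    then obtain B' where B': "B' \<subseteq> B" "card B' = 4" "finite B'"
      using obtain_subset_with_card_n[of 4 B] by blast
    have c: "card (B - B') = card B - 4" using B' by (simp add: card_Diff_subset)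
    have "decomposable (biclique B' A)"
      unfolding biclique_commute[of B'] using assms(1-3) B' less.prems
      by (intro decomposable_biclique_even_4) auto
    moreover have "decomposable (biclique (B - B') A)"
      unfolding biclique_commute[of "B - B'"] using c \<open>card B \<ge> 4\<close> less.prems
      by (intro less.hyps) auto
    ultimately have "decomposable (biclique (B' \<union> (B - B')) A)"
      using B' less.prems(3) by (intro decomposable_biclique_Un) auto
    moreover have "B' \<union> (B - B') = B" using B' by auto
    ultimately show ?thesis by (simp add: biclique_commute)
  qed
qed

section \<open>Uniting packings on sets with at most one common vertex\<close>

lemma complete_edges_Un:
  assumes "X \<inter> Y \<subseteq> {z}"
  shows "complete_edges (X \<union> Y) = complete_edges X \<union> complete_edges Y \<union> biclique (X - Y) (Y - X)"
    and "complete_edges X \<inter> complete_edges Y = {}"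
    and "(complete_edges X \<union> complete_edges Y) \<inter> biclique (X - Y) (Y - X) = {}"
proof -
  \<comment> \<open>An edge in both graphs would be two vertices inside \<open>{z}\<close>.\<close>
  show "complete_edges X \<inter> complete_edges Y = {}"
  proof -
    have False if "e \<subseteq> X \<inter> Y" "card e = 2" for e
      using that assms card_mono[of "{z}" e] by force
    then show ?thesis unfolding complete_edges_eq by blast
  qed
  show "(complete_edges X \<union> complete_edges Y) \<inter> biclique (X - Y) (Y - X) = {}"
    unfolding complete_edges_eq biclique_def by auto
  show "complete_edges (X \<union> Y) = complete_edges X \<union> complete_edges Y \<union> biclique (X - Y) (Y - X)"
  proof (intro subset_antisym subsetI)
    fix e assume "e \<in> complete_edges (X \<union> Y)"
    then obtain u v where e: "e = {u, v}" "u \<noteq> v" "u \<in> X \<union> Y" "v \<in> X \<union> Y"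
      unfolding complete_edges_def by blast
    consider "u \<in> X \<and> v \<in> X" | "u \<in> Y \<and> v \<in> Y" | "u \<in> X - Y \<and> v \<in> Y - X" | "v \<in> X - Y \<and> u \<in> Y - X"
      using e by blast
    moreover have "e = {v, u}" using e(1) by (simp add: insert_commute)
    ultimately show "e \<in> complete_edges X \<union> complete_edges Y \<union> biclique (X - Y) (Y - X)"
      using e(1,2) unfolding complete_edges_def biclique_def by cases blast+
  next
    fix e assume "e \<in> complete_edges X \<union> complete_edges Y \<union> biclique (X - Y) (Y - X)"
    then show "e \<in> complete_edges (X \<union> Y)"
      using complete_edges_mono[of X "X \<union> Y"] complete_edges_mono[of Y "X \<union> Y"]
      unfolding biclique_def by (auto simp: complete_edges_def)
  qed
qed

text \<open>The inside cycles of the cycles of a sub-packing stay inside its vertex set.\<close>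

lemma not_almost_2_perfect8_extend:
  assumes "\<not> almost_2_perfect8 X Cs L" "\<forall>C\<in>Cs. is_8cycle X C" "Cs \<subseteq> Cs'" "L \<subseteq> L'"
  shows "\<not> almost_2_perfect8 X' Cs' L'"
proof
  assume "almost_2_perfect8 X' Cs' L'"
  then obtain f where f: "\<forall>C\<in>Cs'. inside8 X' (f C) C"
    "\<forall>C1\<in>Cs'. \<forall>C2\<in>Cs'. C1 \<noteq> C2 \<longrightarrow> f C1 \<inter> f C2 = {}" "\<forall>C\<in>Cs'. f C \<inter> L' = {}"
    unfolding almost_2_perfect8_def by (elim exE conjE) (rule that)
  have "inside8 X (f C) C" if "C \<in> Cs" for C
  proof -
    have "inside8 X' (f C) C" using f(1) that assms(3) by blast
    then have *: "is_8cycle X' (f C)" "\<Union> (f C) = \<Union> C" "f C \<inter> C = {}"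
      unfolding inside8_def cycle_verts_def by auto
    have "\<Union> C \<subseteq> X" using assms(2) that is_8cycle_iff[of X C] by blast
    then have "is_8cycle X (f C)" using * is_8cycle_iff[of X "f C"] is_8cycle_iff[of X' "f C"] by blast
    then show ?thesis
      unfolding inside8_def cycle_verts_def using * by blast
  qed
  moreover have "\<forall>C1\<in>Cs. \<forall>C2\<in>Cs. C1 \<noteq> C2 \<longrightarrow> f C1 \<inter> f C2 = {}"
    using f(2) assms(3) by (simp add: subset_iff)
  moreover have "\<forall>C\<in>Cs. f C \<inter> L = {}"
    using f(3) assms(3,4) by fast
  ultimately have "almost_2_perfect8 X Cs L"
    unfolding almost_2_perfect8_def by (intro exI[of _ f]) simp
  with assms(1) show False ..
qed

text \<open>The two packings and a decomposition of the cross edges are joined. Cross edges are all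
  covered, so the new leave is the disjoint union of the old ones, and the obstruction in
  \<open>Cs\<close> persists in the extension.\<close>

lemma packing8_glue:
  assumes P: "packing8 X Cs L" and Q: "packing8 Y Ds M" and fin: "finite X" "finite Y"
    and XY: "X \<inter> Y \<subseteq> {z}" and B: "decomposable (biclique (X - Y) (Y - X))"
    and not: "\<not> almost_2_perfect8 X Cs L"
  shows "\<exists>Cs' L'. packing8 (X \<union> Y) Cs' L' \<and> \<not> almost_2_perfect8 (X \<union> Y) Cs' L' \<and>
    card L' = card L + card M"
proof -
  let ?B = "biclique (X - Y) (Y - X)"
  note E = complete_edges_Un[OF XY]
  note P' = packing_cycles[OF fin(1) P] packing_disjoint[OF fin(1) P]
    packing_leave[OF fin(1) P] packing_Union_subset[OF fin(1) P]
  note Q' = packing_cycles[OF fin(2) Q] packing_disjoint[OF fin(2) Q]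
    packing_leave[OF fin(2) Q] packing_Union_subset[OF fin(2) Q]
  obtain Bs where Bs: "\<forall>C\<in>Bs. is_8cycle UNIV C" "\<Union> Bs = ?B"
    "\<forall>C1\<in>Bs. \<forall>C2\<in>Bs. C1 \<noteq> C2 \<longrightarrow> C1 \<inter> C2 = {}"
    by (rule decomposableE[OF B])
  let ?A = "Cs \<union> Ds \<union> Bs"
  have "is_8cycle (X \<union> Y) C" if "C \<in> ?A" for C
  proof -
    consider "is_8cycle X C" | "is_8cycle Y C" | "C \<in> Bs" using \<open>C \<in> ?A\<close> P'(1) Q'(1) by auto
    then show ?thesis
    proof cases
      case 3
      then have "C \<subseteq> ?B" unfolding Bs(2)[symmetric] by (rule Union_upper)
      then have "\<Union> C \<subseteq> X \<union> Y" unfolding biclique_def by fastforce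
      moreover have "is_8cycle UNIV C" using 3 Bs(1) by simp
      ultimately show ?thesis by (simp add: is_8cycle_iff[of "X \<union> Y"])
    qed (auto simp: is_8cycle_iff[of X] is_8cycle_iff[of Y] is_8cycle_iff[of "X \<union> Y"])
  qed
  moreover have "C1 \<inter> C2 = {}" if "C1 \<in> ?A" "C2 \<in> ?A" "C1 \<noteq> C2" for C1 C2
  proof -
    have "C \<inter> D = {}" if "C \<in> Cs" "D \<in> Ds" for C D using that P'(4) Q'(4) E(2) by blast
    moreover have "C \<inter> D = {}" if "C \<in> Cs \<union> Ds" "D \<in> Bs" for C D
      using that P'(4) Q'(4) Bs(2) E(3) by blast
    moreover have "D \<inter> C = {}" if "C \<inter> D = {}" for C D :: "'a set set" using that by blast
    ultimately show ?thesis using that P'(2) Q'(2) Bs(3) by (elim UnE) simp_all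
  qed
  moreover have "L \<union> M = complete_edges (X \<union> Y) - \<Union> ?A"
    unfolding E(1) P'(3) Q'(3) using P'(4) Q'(4) Bs(2) E(2,3) by blast
  ultimately have "packing8 (X \<union> Y) ?A (L \<union> M)"
    unfolding packing8_def by blast
  moreover have "\<not> almost_2_perfect8 (X \<union> Y) ?A (L \<union> M)"
    by (rule not_almost_2_perfect8_extend[OF not]) (use P'(1) in auto)
  moreover have "card (L \<union> M) = card L + card M"
    using packing_finite_leave[OF fin(1) P] packing_finite_leave[OF fin(2) Q] P'(3) Q'(3) E(2)
    by (intro card_Un_disjoint) auto
  ultimately show ?thesis by blast
qed

text \<open>Only the cycles are relabelled by a bijection; the new leave is defined as the
  complement, and its size follows by counting.\<close>

lemma packing8_transfer:
  assumes P: "packing8 X Cs L" and X: "finite X" and Y: "finite Y" "card Y = card X"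
  shows "\<exists>Ds M. packing8 Y Ds M \<and> card M = card L"
proof -
  obtain g where g: "bij_betw g X Y"
    using X Y finite_same_card_bij by metis
  then have inj: "inj_on g X" and im: "g ` X = Y" by (auto simp: bij_betw_def)
  have sub: "\<Union> (\<Union> Cs) \<subseteq> X"
    using packing_Union_subset[OF X P] by (auto simp: complete_edges_eq)
  have "is_8cycle UNIV C" if "C \<in> Cs" for C
    using packing_cycles[OF X P that] is_8cycle_iff by blast
  then have "decomposable (\<Union> Cs)"
    unfolding decomposable_def using packing_disjoint[OF X P] by (intro exI[of _ Cs]) simp
  then have "decomposable ((`) g ` \<Union> Cs)"
    by (rule decomposable_image) (rule inj_on_subset[OF inj sub])
  then obtain Ds where Ds: "\<forall>C\<in>Ds. is_8cycle UNIV C" "\<Union> Ds = (`) g ` \<Union> Cs"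
     "\<forall>C1\<in>Ds. \<forall>C2\<in>Ds. C1 \<noteq> C2 \<longrightarrow> C1 \<inter> C2 = {}"
    by (rule decomposableE)
  have "\<Union> (\<Union> Ds) \<subseteq> Y" unfolding Ds(2) using sub im by blast
  then have "is_8cycle Y C" if "C \<in> Ds" for C
    using Ds(1) that is_8cycle_iff[of Y C] by blast
  then have Q: "packing8 Y Ds (complete_edges Y - \<Union> Ds)"
    unfolding packing8_def using Ds(3) by blast
  \<comment> \<open>Relabelling keeps the number of covered edges, hence the number of cycles, hence
    the size of the leave.\<close>
  have "inj_on ((`) g) (\<Union> Cs)"
    by (rule inj_on_subset[OF inj_on_image_Pow[OF inj]]) (use sub in auto)
  then have "card (\<Union> Ds) = card (\<Union> Cs)" unfolding Ds(2) by (rule card_image)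
  then have "card Ds = card Cs"
    using packing_card_Union[OF X P] packing_card_Union[OF Y(1) Q] by simp
  then have "card (complete_edges Y - \<Union> Ds) = card L"
    using packing_card_leave[OF X P] packing_card_leave[OF Y(1) Q] Y(2) by simp
  with Q show ?thesis by blast
qed

subsection \<open>An edge shared by a single cycle\<close>

text \<open>Avoiding the leave puts the inside cycles within the covered edges, and both sides have
  \<open>8 * card Cs\<close> edges.\<close>

lemma almost_2_perfect8_Union:
  assumes X: "finite X" and P: "packing8 X Cs L"
    and ins: "\<forall>C\<in>Cs. inside8 X (f C) C"
    and dis: "\<forall>C1\<in>Cs. \<forall>C2\<in>Cs. C1 \<noteq> C2 \<longrightarrow> f C1 \<inter> f C2 = {}"
    and avoid: "\<forall>C\<in>Cs. f C \<inter> L = {}"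
  shows "(\<Union>C\<in>Cs. f C) = \<Union> Cs"
proof (rule card_subset_eq)
  have cyc: "is_8cycle X (f C)" if "C \<in> Cs" for C
    using ins that by (simp add: inside8_def)
  have "f C \<subseteq> \<Union> Cs" if "C \<in> Cs" for C
    using is_8cycle_subset_complete[OF cyc[OF that]] avoid that packing_leave[OF X P] by blast
  then show "(\<Union>C\<in>Cs. f C) \<subseteq> \<Union> Cs" by blast
  have "card (\<Union>C\<in>Cs. f C) = (\<Sum>C\<in>Cs. card (f C))"
    using packing_finite[OF X P] finite_8cycle[OF cyc] dis by (intro card_UN_disjoint) auto
  also have "\<dots> = (\<Sum>C\<in>Cs. 8)"
    using card_8cycle[OF cyc] by (intro sum.cong) auto
  finally show "card (\<Union>C\<in>Cs. f C) = card (\<Union> Cs)"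
    by (simp add: packing_card_Union[OF X P])
  show "finite (\<Union> Cs)"
    using packing_Union_subset[OF X P] finite_complete_edges[OF X] by (rule finite_subset)
qed

text \<open>By the covering property \<open>e\<close> would lie in the inside cycle of some
  \<open>C\<close>. That \<open>C\<close> passes through both ends of \<open>e\<close>, so it
  contains \<open>e\<close> too, although it shares no edge with its inside cycle.\<close>

lemma not_almost_2_perfect8_single_edge:
  assumes X: "finite X" and P: "packing8 X Cs L" and e: "e \<in> \<Union> Cs"
    and single: "\<And>C. C \<in> Cs \<Longrightarrow> e \<subseteq> \<Union> C \<Longrightarrow> e \<in> C"
  shows "\<not> almost_2_perfect8 X Cs L"
proof
  assume "almost_2_perfect8 X Cs L"
  then obtain f where f: "\<forall>C\<in>Cs. inside8 X (f C) C"
    "\<forall>C1\<in>Cs. \<forall>C2\<in>Cs. C1 \<noteq> C2 \<longrightarrow> f C1 \<inter> f C2 = {}" "\<forall>C\<in>Cs. f C \<inter> L = {}"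
    unfolding almost_2_perfect8_def by (elim exE conjE) (rule that)
  obtain C where C: "C \<in> Cs" "e \<in> f C"
    using e almost_2_perfect8_Union[OF X P f] by blast
  then have "\<Union> (f C) = \<Union> C" "f C \<inter> C = {}"
    using f(1) by (auto simp: inside8_def cycle_verts_def)
  then have "e \<subseteq> \<Union> C" "e \<notin> C" using C(2) by blast+
  with single[OF C(1)] show False by blast
qed

subsection \<open>Packings given by lists\<close>

text \<open>Putting the smaller end first gives each edge one representative, so that comparing
  edges is comparing pairs of numbers.\<close>

definition sort_pair :: "nat \<Rightarrow> nat \<Rightarrow> nat \<times> nat" where
  "sort_pair a b = (if a \<le> b then (a, b) else (b, a))"

definition edge_list :: "nat list \<Rightarrow> (nat \<times> nat) list" where
  "edge_list vs = map2 sort_pair vs (rotate1 vs)"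

definition edge_of :: "nat \<times> nat \<Rightarrow> nat set" where
  "edge_of p = {fst p, snd p}"

text \<open>One distinctness test on the concatenated edges makes the cycles edge-disjoint and also
  excludes that a cycle is listed twice.\<close>

definition packing_list :: "nat \<Rightarrow> nat list list \<Rightarrow> bool" where
  "packing_list n css \<longleftrightarrow>
    (\<forall>vs\<in>set css. length vs = 8 \<and> distinct vs \<and> (\<forall>v\<in>set vs. v < n)) \<and>
    distinct (concat (map edge_list css))"

lemma edge_of_sort_pair: "edge_of (sort_pair a b) = {a, b}"
  by (auto simp: edge_of_def sort_pair_def)

lemma inj_on_edge_of: "inj_on edge_of {p. fst p \<le> snd p}"
  by (auto simp: inj_on_def edge_of_def doubleton_eq_iff prod_eq_iff)

lemma edge_list_sorted: "p \<in> set (edge_list vs) \<Longrightarrow> fst p \<le> snd p"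
  by (auto simp: edge_list_def sort_pair_def split: if_splits)

lemma cycle_edges_edge_list: "length vs = 8 \<Longrightarrow> cycle_edges vs = edge_of ` set (edge_list vs)"
  by (erule length_8E) (simp add: cycle_edges_8 edge_list_def edge_of_sort_pair)

lemma edge_of_mem_cycle_edges:
  assumes "length vs = 8" "fst p \<le> snd p"
  shows "edge_of p \<in> cycle_edges vs \<longleftrightarrow> p \<in> set (edge_list vs)"
  unfolding cycle_edges_edge_list[OF assms(1)]
  using assms(2) edge_list_sorted by (intro inj_on_image_mem_iff[OF inj_on_edge_of]) auto

lemma packing_list_cycles_disjoint:
  assumes "packing_list n css" "i < length css" "j < length css" "i \<noteq> j"
  shows "cycle_edges (css ! i) \<inter> cycle_edges (css ! j) = {}"
proof -
  have "set (edge_list (css ! i)) \<inter> set (edge_list (css ! j)) = {}" if "i < j" "j < length css" for i j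
  proof -
    \<comment> \<open>Cutting the list before position \<open>j\<close> separates the two cycles,
      since \<open>i < j\<close>.\<close>
    have "distinct (concat (map edge_list css))" using assms(1) by (simp add: packing_list_def)
    also have "css = take j css @ drop j css" by simp
    finally have "set (concat (map edge_list (take j css))) \<inter> set (concat (map edge_list (drop j css))) = {}"
      unfolding map_append concat_append distinct_append by blast
    moreover have "css ! i \<in> set (take j css)"
      using that nth_mem[of i "take j css"] by simp
    moreover have "css ! j \<in> set (drop j css)"
      using that nth_mem[of 0 "drop j css"] by simp
    ultimately show ?thesis by auto
  qed
  then have "set (edge_list (css ! i)) \<inter> set (edge_list (css ! j)) = {}"
    using assms(2-4) by (metis Int_commute linorder_neqE_nat)
  moreover have "length (css ! i) = 8" "length (css ! j) = 8"
    using assms by (auto simp: packing_list_def)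
  moreover have "edge_of ` (set (edge_list (css ! i)) \<inter> set (edge_list (css ! j))) =
      edge_of ` set (edge_list (css ! i)) \<inter> edge_of ` set (edge_list (css ! j))"
    using edge_list_sorted by (intro inj_on_image_Int[OF inj_on_edge_of] subsetI CollectI)
  ultimately show ?thesis
    by (simp add: cycle_edges_edge_list)
qed

lemma packing_list_packing8:
  assumes "packing_list n css"
  defines "Cs \<equiv> cycle_edges ` set css"
  defines "L \<equiv> complete_edges {..<n} - \<Union> Cs"
  shows "packing8 {..<n} Cs L" "card L + 8 * length css = n choose 2"
proof -
  note dis = packing_list_cycles_disjoint[OF assms(1)]
  have len: "length vs = 8 \<and> distinct vs \<and> set vs \<subseteq> {..<n}" if "vs \<in> set css" for vs
    using assms(1) that by (auto simp: packing_list_def)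
  show P: "packing8 {..<n} Cs L"
    unfolding packing8_def
  proof (intro conjI ballI impI)
    show "is_8cycle {..<n} C" if "C \<in> Cs" for C
      using that len unfolding Cs_def is_8cycle_def by blast
    show "C1 \<inter> C2 = {}" if C: "C1 \<in> Cs" "C2 \<in> Cs" "C1 \<noteq> C2" for C1 C2
    proof -
      obtain i j where "i < length css" "j < length css"
        "C1 = cycle_edges (css ! i)" "C2 = cycle_edges (css ! j)"
        using C(1,2) unfolding Cs_def by (auto simp: in_set_conv_nth)
      then show ?thesis using C(3) dis[of i j] by (cases "i = j") simp_all
    qed
  qed (simp add: L_def)
  have "card Cs = length css"
  proof -
    \<comment> \<open>Equal edge sets at two positions would be disjoint from themselves, hence
      empty, and not of size 8.\<close>
    have "inj_on (\<lambda>i. cycle_edges (css ! i)) {..<length css}"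
    proof (rule inj_onI, rule ccontr)
      fix i j assume ij: "i \<in> {..<length css}" "j \<in> {..<length css}"
        "cycle_edges (css ! i) = cycle_edges (css ! j)" "i \<noteq> j"
      then have "cycle_edges (css ! i) = {}" using dis[of i j] by simp
      moreover have "is_8cycle {..<n} (cycle_edges (css ! i))"
        using ij(1) len[of "css ! i"] unfolding is_8cycle_def by auto
      ultimately show False using card_8cycle by force
    qed
    moreover have "Cs = (\<lambda>i. cycle_edges (css ! i)) ` {..<length css}"
      unfolding Cs_def by (auto simp: set_conv_nth)
    ultimately show ?thesis by (simp add: card_image)
  qed
  then show "card L + 8 * length css = n choose 2"
    using packing_card_leave[OF _ P] by simp
qed

text \<open>Computable form of the hypotheses on \<open>e\<close> in
  \<open>not_almost_2_perfect8_single_edge\<close>.\<close>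

definition single_edge :: "nat \<times> nat \<Rightarrow> nat list list \<Rightarrow> bool" where
  "single_edge p css \<longleftrightarrow> fst p \<le> snd p \<and> (\<exists>vs\<in>set css. p \<in> set (edge_list vs)) \<and>
    (\<forall>vs\<in>set css. fst p \<in> set vs \<longrightarrow> snd p \<in> set vs \<longrightarrow> p \<in> set (edge_list vs))"

text \<open>For \<open>n\<close> even respectively odd, the leave of a good packing is as small as parity and
  divisibility by 8 permit.\<close>

definition good :: "nat \<Rightarrow> bool" where
  "good n \<longleftrightarrow> (\<exists>Cs L. packing8 {..<n} Cs L \<and> \<not> almost_2_perfect8 {..<n} Cs L \<and>
    (if even n then card L < n div 2 + 8 else card L \<le> 10 \<and> card L \<noteq> 8))"

text \<open>Reduces a single order to evaluations on lists. The leave is never listed; its size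
  \<open>l\<close> comes from counting edges.\<close>

lemma good_single_edge:
  assumes css: "packing_list n css" and p: "single_edge p css"
    and size: "n choose 2 = l + 8 * length css" "if even n then l < n div 2 + 8 else l \<le> 10 \<and> l \<noteq> 8"
  shows "good n"
proof -
  let ?Cs = "cycle_edges ` set css"
  let ?L = "complete_edges {..<n} - \<Union> ?Cs"
  note P = packing_list_packing8[OF css]
  have len: "length vs = 8" if "vs \<in> set css" for vs
    using css that by (auto simp: packing_list_def)
  have "\<not> almost_2_perfect8 {..<n} ?Cs ?L"
  proof (rule not_almost_2_perfect8_single_edge[OF _ P(1)])
    show "edge_of p \<in> \<Union> ?Cs"
      using p len edge_of_mem_cycle_edges by (fastforce simp: single_edge_def)
    fix C assume "C \<in> ?Cs" and sub: "edge_of p \<subseteq> \<Union> C"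
    then obtain vs where vs: "vs \<in> set css" "C = cycle_edges vs" by blast
    then have "fst p \<in> set vs" "snd p \<in> set vs"
      using sub Union_cycle_edges[OF len[OF vs(1)]] by (auto simp: edge_of_def)
    then show "edge_of p \<in> C"
      using p vs edge_of_mem_cycle_edges[OF len[OF vs(1)], of p] by (simp add: single_edge_def)
  qed simp
  moreover have "card ?L = l" using P(2) size(1) by simp
  ultimately show ?thesis using P(1) size(2) unfolding good_def by blast
qed

subsection \<open>Induction steps\<close>

lemma good_max_packing8:
  assumes "good n"
  shows "\<exists>Cs L. max_packing8 {..<n} Cs L \<and> \<not> almost_2_perfect8 {..<n} Cs L"
proof -
  obtain Cs L where "packing8 {..<n} Cs L" "\<not> almost_2_perfect8 {..<n} Cs L"
    "if even n then card L < n div 2 + 8 else card L \<le> 10 \<and> card L \<noteq> 8"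
    using assms unfolding good_def by (elim exE conjE) (rule that)
  then show ?thesis
    by (intro exI[of _ Cs] exI[of _ L] conjI max_packing8I) (auto split: if_splits)
qed

text \<open>Eight new vertices carry a packing with 4 leave edges. The leave grows by 4, exactly as
  the bound \<open>n div 2 + 8\<close> does.\<close>

lemma good_add_8:
  assumes n: "good n" "even n" "n \<ge> 4" and Q: "packing8 {..<8::nat} Ds M" "card M = 4"
  shows "good (n + 8)"
proof -
  obtain Cs L where P: "packing8 {..<n} Cs L" "\<not> almost_2_perfect8 {..<n} Cs L"
    "card L < n div 2 + 8"
    using n(1,2) unfolding good_def by auto
  obtain Ds' M' where Q': "packing8 {n..<n+8} Ds' M'" "card M' = 4"
    using packing8_transfer[OF Q(1), of "{n..<n+8}"] Q(2) by auto
  have X: "{..<n} - {n..<n+8} = {..<n}" "{n..<n+8} - {..<n} = {n..<n+8}" "{..<n} \<union> {n..<n+8} = {..<n+8}"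
    by auto
  \<comment> \<open>The sets are disjoint; \<open>0\<close> merely fills the place of the possible
    common vertex.\<close>
  have I: "{..<n} \<inter> {n..<n+8} \<subseteq> {0}" by auto
  have "decomposable (biclique {..<n} {n..<n+8})"
    using n(2,3) by (intro decomposable_biclique) auto
  then obtain Cs' L' where R: "packing8 {..<n+8} Cs' L'" "\<not> almost_2_perfect8 {..<n+8} Cs' L'"
    "card L' = card L + card M'"
    using packing8_glue[OF P(1) Q'(1) _ _ I] P(2) unfolding X by auto
  show ?thesis unfolding good_def
    by (intro exI[of _ Cs'] exI[of _ L'] conjI R) (use R(3) Q' P n in auto)
qed

text \<open>Sixteen new vertices together with the old vertex 0 carry a decomposition without leave,
  so the leave keeps its size. The cross edges join \<open>n - 1\<close> old vertices, an even
  number of at least 4, to 16 new ones.\<close>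

lemma good_add_16:
  assumes n: "good n" "odd n" "n \<ge> 5" and Q: "packing8 {..<17::nat} Ds {}"
  shows "good (n + 16)"
proof -
  let ?Y = "insert 0 {n..<n+16}"
  obtain Cs L where P: "packing8 {..<n} Cs L" "\<not> almost_2_perfect8 {..<n} Cs L"
    "card L \<le> 10" "card L \<noteq> 8"
    using n(1,2) unfolding good_def by auto
  have "card ?Y = 17" using n(3) by simp
  then obtain Ds' M' where Q': "packing8 ?Y Ds' M'" "card M' = 0"
    using packing8_transfer[OF Q, of ?Y] by auto
  have X: "{..<n} - ?Y = {1..<n}" "?Y - {..<n} = {n..<n+16}" "{..<n} \<union> ?Y = {..<n+16}"
    using n(3) by auto
  have I: "{..<n} \<inter> ?Y \<subseteq> {0}" by auto
  have "decomposable (biclique {1..<n} {n..<n+16})"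
    using n(2,3) by (intro decomposable_biclique) auto
  then obtain Cs' L' where R: "packing8 {..<n+16} Cs' L'" "\<not> almost_2_perfect8 {..<n+16} Cs' L'"
    "card L' = card L + card M'"
    using packing8_glue[OF P(1) Q'(1) _ _ I] P(2) unfolding X by auto
  show ?thesis unfolding good_def
    by (intro exI[of _ Cs'] exI[of _ L'] conjI R) (use R(3) Q' P n in auto)
qed

subsection \<open>The packing of order 10\<close>

text \<open>With 10 vertices every pair of vertices lies in at least three of the five cycles, so that
  no edge is shared by a single cycle. In the packing chosen below, every edge admits exactly two
  cycles whose inside cycles may contain it, and every vertex of a cycle is incident to exactly
  four edges admissible for the inside cycle, two of which must be used and two of which must not.
  A triple \<open>(p, x, y)\<close> records the decision that the edge \<open>p\<close> is used by the inside cycle of the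
  cycle with index \<open>x\<close> and not by that of index \<open>y\<close>; the function \<open>dead\<close> explores all decisions.\<close>

definition incident :: "nat \<Rightarrow> nat \<times> nat \<Rightarrow> bool" where
  "incident v p \<longleftrightarrow> v = fst p \<or> v = snd p"

text \<open>\<open>ds\<close> holds the decisions taken before \<open>d\<close>, so finding 2 of
  them means that \<open>d\<close> would be the third of its kind at an endpoint.\<close>

definition exceeded :: "(nat \<times> nat) \<times> nat \<times> nat \<Rightarrow> ((nat \<times> nat) \<times> nat \<times> nat) list \<Rightarrow> bool" where
  "exceeded d ds = (case d of (p, x, y) \<Rightarrow> list_ex (\<lambda>v.
     2 \<le> length (filter (\<lambda>(q, x', y'). x' = x \<and> incident v q) ds) \<or>
     2 \<le> length (filter (\<lambda>(q, x', y'). y' = y \<and> incident v q) ds)) [fst p, snd p])"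

text \<open>An empty list of edges yields \<open>False\<close>, because a complete run of decisions
  has then survived. The conditionals stop evaluation at a branch already closed by
  \<open>exceeded\<close>.\<close>

fun dead :: "((nat \<times> nat) \<times> nat \<times> nat) list \<Rightarrow> ((nat \<times> nat) \<times> nat \<times> nat) list \<Rightarrow> bool" where
  "dead ds [] = False"
| "dead ds ((p, i, j) # es) =
    (if (if exceeded (p, i, j) ds then True else dead ((p, i, j) # ds) es)
     then (if exceeded (p, j, i) ds then True else dead ((p, j, i) # ds) es) else False)"

text \<open>\<open>P i\<close> stands for the edges of an actual inside cycle of the cycle with
  index \<open>i\<close>, and \<open>A i\<close> for its admissible edges; the decisions in
  \<open>ds\<close> are those that this choice takes.\<close>

definition consistent :: "(nat \<Rightarrow> (nat \<times> nat) set) \<Rightarrow> (nat \<Rightarrow> (nat \<times> nat) set) \<Rightarrow> nat \<Rightarrow>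
    ((nat \<times> nat) \<times> nat \<times> nat) list \<Rightarrow> bool" where
  "consistent P A m ds \<longleftrightarrow> distinct (map fst ds) \<and>
    (\<forall>(p, x, y) \<in> set ds. x < m \<and> y < m \<and> p \<in> P x \<and> p \<in> A y - P y)"

context
  fixes P :: "nat \<Rightarrow> (nat \<times> nat) set" and A :: "nat \<Rightarrow> (nat \<times> nat) set" and m :: nat
  assumes fin: "\<And>i. finite (P i)" "\<And>i. finite (A i)"
    and used: "\<And>i v. i < m \<Longrightarrow> card {p \<in> P i. incident v p} \<le> 2"
    and unused: "\<And>i v. i < m \<Longrightarrow> card {p \<in> A i - P i. incident v p} \<le> 2"
begin

lemma consistent_not_exceeded:
  assumes "consistent P A m (d # ds)"
  shows "\<not> exceeded d ds"
proof -
  obtain p x y where d: "d = (p, x, y)" by (cases d)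
  \<comment> \<open>Decisions concern distinct edges, so those satisfying \<open>Q\<close> are
    counted by edges in \<open>S\<close>. One of the at most two is \<open>d\<close> itself, which
    leaves one in \<open>ds\<close>.\<close>
  have cnt: "length (filter Q ds) \<le> 1"
    if Q: "\<And>d'. d' \<in> set (d # ds) \<Longrightarrow> Q d' \<Longrightarrow> fst d' \<in> S" and "Q d" "finite S" "card S \<le> 2" for Q S
  proof -
    have "distinct (map fst (filter Q (d # ds)))"
      using assms unfolding consistent_def by (intro distinct_map_filter) simp
    then have "length (filter Q (d # ds)) = card (set (map fst (filter Q (d # ds))))"
      by (metis distinct_card length_map)
    also have "\<dots> \<le> card S"
    proof (rule card_mono[OF \<open>finite S\<close>], rule subsetI)
      fix q assume "q \<in> set (map fst (filter Q (d # ds)))"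
      then obtain d' where "d' \<in> set (filter Q (d # ds))" "q = fst d'" unfolding set_map by blast
      then show "q \<in> S" using Q[of d'] by (auto split: if_splits)
    qed
    finally show ?thesis using that by simp
  qed
  have con: "x' < m \<and> y' < m \<and> q \<in> P x' \<and> q \<in> A y' - P y'" if "(q, x', y') \<in> set (d # ds)" for q x' y'
    using assms that unfolding consistent_def by blast
  have xy: "x < m" "y < m" using con[of p x y] d by auto
  have "length (filter (\<lambda>(q, x', y'). x' = x \<and> incident v q) ds) \<le> 1 \<and>
      length (filter (\<lambda>(q, x', y'). y' = y \<and> incident v q) ds) \<le> 1" if "v = fst p \<or> v = snd p" for v
  proof (intro conjI)
    show "length (filter (\<lambda>(q, x', y'). x' = x \<and> incident v q) ds) \<le> 1"
    proof (rule cnt[of _ "{q \<in> P x. incident v q}"])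
      fix d' assume "d' \<in> set (d # ds)" "case d' of (q, x', y') \<Rightarrow> x' = x \<and> incident v q"
      then show "fst d' \<in> {q \<in> P x. incident v q}" using con[of "fst d'" "fst (snd d')" "snd (snd d')"] by (auto simp: split_beta)
    qed (use d that fin used[OF xy(1)] in \<open>auto simp: incident_def\<close>)
    show "length (filter (\<lambda>(q, x', y'). y' = y \<and> incident v q) ds) \<le> 1"
    proof (rule cnt[of _ "{q \<in> A y - P y. incident v q}"])
      fix d' assume "d' \<in> set (d # ds)" "case d' of (q, x', y') \<Rightarrow> y' = y \<and> incident v q"
      then show "fst d' \<in> {q \<in> A y - P y. incident v q}" using con[of "fst d'" "fst (snd d')" "snd (snd d')"] by (auto simp: split_beta)
    qed (use d that fin unused[OF xy(2)] in \<open>auto simp: incident_def\<close>)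
  qed
  from this[of "fst p"] this[of "snd p"] show ?thesis
    by (simp add: exceeded_def d)
qed

text \<open>The actual choice \<open>P\<close> selects one branch at every edge. Its decisions stay
  consistent, so by \<open>consistent_not_exceeded\<close> this branch is never closed.\<close>

lemma not_dead:
  assumes "consistent P A m ds" "distinct (map fst (ds @ es))"
    and "\<forall>(p, i, j) \<in> set es. i < m \<and> j < m \<and> p \<in> A i \<and> p \<in> A j \<and> (p \<in> P i \<longleftrightarrow> p \<notin> P j)"
  shows "\<not> dead ds es"
  using assms
proof (induction es arbitrary: ds)
  case (Cons e es)
  obtain p i j where e: "e = (p, i, j)" by (cases e)
  have branch: "\<not> (if exceeded d ds then True else dead (d # ds) es)"
    if "d = (p, x, y)" "{x, y} = {i, j}" "p \<in> P x" "p \<notin> P y" for d x y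
  proof -
    have "consistent P A m (d # ds)"
      using Cons.prems that e unfolding consistent_def by (auto simp: doubleton_eq_iff)
    moreover have "distinct (map fst ((d # ds) @ es))"
      using Cons.prems(2) that(1) e by auto
    ultimately show ?thesis
      using Cons.IH Cons.prems(3) consistent_not_exceeded by auto
  qed
  have "p \<in> P i \<longleftrightarrow> p \<notin> P j" using Cons.prems(3) e by auto
  then show ?case
    using branch[of "(p, i, j)" i j] branch[of "(p, j, i)" j i] unfolding e by (auto simp: insert_commute)
qed simp

end

text \<open>Candidates come from the covered edges only, which keeps out the leave.\<close>

definition allowed :: "nat list list \<Rightarrow> nat \<Rightarrow> (nat \<times> nat) list" where
  "allowed css i = filter (\<lambda>p. fst p \<in> set (css ! i) \<and> snd p \<in> set (css ! i) \<and>
     p \<notin> set (edge_list (css ! i))) (concat (map edge_list css))"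

text \<open>A choice of inside cycles would provide sets \<open>P i\<close> that meet the hypotheses
  of \<open>not_dead\<close>, against the outcome of the search.\<close>

lemma not_almost_2_perfect8_dead:
  assumes css: "packing_list n css"
    and four: "\<forall>i<length css. \<forall>v\<in>set (css ! i). length (filter (incident v) (allowed css i)) \<le> 4"
    and opts: "\<forall>(p, i, j)\<in>set es. i < length css \<and> j < length css \<and> i \<noteq> j \<and>
      p \<in> set (allowed css i) \<and> p \<in> set (allowed css j) \<and>
      (\<forall>k<length css. p \<in> set (allowed css k) \<longrightarrow> k = i \<or> k = j)"
    and es: "distinct (map fst es)" "dead [] es"
  defines "Cs \<equiv> cycle_edges ` set css"
  shows "\<not> almost_2_perfect8 {..<n} Cs (complete_edges {..<n} - \<Union> Cs)"
proof
  let ?L = "complete_edges {..<n} - \<Union> Cs" and ?m = "length css"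
  assume "almost_2_perfect8 {..<n} Cs ?L"
  then obtain f where f: "\<forall>C\<in>Cs. inside8 {..<n} (f C) C"
    "\<forall>C1\<in>Cs. \<forall>C2\<in>Cs. C1 \<noteq> C2 \<longrightarrow> f C1 \<inter> f C2 = {}" "\<forall>C\<in>Cs. f C \<inter> ?L = {}"
    unfolding almost_2_perfect8_def by (elim exE conjE) (rule that)
  have pack: "packing8 {..<n} Cs ?L" unfolding Cs_def by (rule packing_list_packing8(1)[OF css])
  have cover: "(\<Union>C\<in>Cs. f C) = \<Union> Cs" by (rule almost_2_perfect8_Union[OF _ pack f]) simp
  define D where "D i = f (cycle_edges (css ! i))" for i
  define P where "P i = {p \<in> set (concat (map edge_list css)). edge_of p \<in> D i}" for i
  have len: "length vs = 8" if "vs \<in> set css" for vs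
    using css that by (auto simp: packing_list_def)
  have sorted: "fst p \<le> snd p" if "p \<in> set (concat (map edge_list css))" for p
    using that edge_list_sorted by auto
  have C: "cycle_edges (css ! i) \<in> Cs" if "i < ?m" for i
    using that unfolding Cs_def by simp
  have D: "is_8cycle {..<n} (D i)" "\<Union> (D i) = set (css ! i)" "D i \<inter> cycle_edges (css ! i) = {}"
    "D i \<subseteq> \<Union> Cs" if "i < ?m" for i
  proof -
    have "inside8 {..<n} (D i) (cycle_edges (css ! i))"
      unfolding D_def using f(1) C[OF that] by blast
    then show "is_8cycle {..<n} (D i)" "\<Union> (D i) = set (css ! i)" "D i \<inter> cycle_edges (css ! i) = {}"
      using that by (auto simp: inside8_def cycle_verts_def Union_cycle_edges len)
    show "D i \<subseteq> \<Union> Cs" unfolding D_def using cover C[OF that] by blast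
  qed
  have PA: "P i \<subseteq> set (allowed css i)" if "i < ?m" for i
  proof
    fix p assume p: "p \<in> P i"
    then have "edge_of p \<in> D i" "p \<in> set (concat (map edge_list css))" unfolding P_def by auto
    then have "edge_of p \<subseteq> set (css ! i)" "edge_of p \<notin> cycle_edges (css ! i)"
      using D(2,3)[OF that] by blast+
    moreover have "edge_of p \<in> cycle_edges (css ! i) \<longleftrightarrow> p \<in> set (edge_list (css ! i))"
      using len that sorted p unfolding P_def by (intro edge_of_mem_cycle_edges) auto
    ultimately show "p \<in> set (allowed css i)"
      using p unfolding allowed_def P_def by (simp add: edge_of_def)
  qed
  have deg: "card {p \<in> P i. incident v p} = (if v \<in> set (css ! i) then 2 else 0)" if i: "i < ?m" for i v
  proof -
    have "inj_on edge_of {p \<in> P i. incident v p}"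
      by (rule inj_on_subset[OF inj_on_edge_of]) (use sorted in \<open>auto simp: P_def\<close>)
    then have "card {p \<in> P i. incident v p} = card (edge_of ` {p \<in> P i. incident v p})"
      by (simp add: card_image)
    also have "edge_of ` {p \<in> P i. incident v p} = {e \<in> D i. v \<in> e}"
    proof (intro subset_antisym subsetI)
      fix e assume e: "e \<in> {e \<in> D i. v \<in> e}"
      then obtain vs where vs: "vs \<in> set css" "e \<in> cycle_edges vs"
        using D(4)[OF i] unfolding Cs_def by blast
      then obtain p where "p \<in> set (edge_list vs)" "e = edge_of p"
        using cycle_edges_edge_list[OF len] by auto
      with e vs show "e \<in> edge_of ` {p \<in> P i. incident v p}"
        by (auto simp: P_def incident_def edge_of_def)
    qed (auto simp: P_def incident_def edge_of_def)
    also have "card \<dots> = (if v \<in> set (css ! i) then 2 else 0)"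
    proof (cases "v \<in> set (css ! i)")
      case True
      then show ?thesis using degree_8cycle[OF D(1)[OF that]] D(2)[OF that] by simp
    next
      case False
      then have "{e \<in> D i. v \<in> e} = {}" using D(2)[OF that] by blast
      then show ?thesis using False by (simp only: card.empty if_False)
    qed
    finally show ?thesis .
  qed
  have "\<not> dead [] es"
  proof (rule not_dead[where P = P and A = "\<lambda>i. set (allowed css i)" and m = ?m])
    show "finite (P i)" for i unfolding P_def by simp
    show "card {p \<in> P i. incident v p} \<le> 2" if "i < ?m" for i v
      using deg[OF that] by simp
    \<comment> \<open>At a vertex of the cycle there are at most four admissible edges, two of them
      used; at other vertices there are none.\<close>
    show "card {p \<in> set (allowed css i) - P i. incident v p} \<le> 2" if "i < ?m" for i v
    proof (cases "v \<in> set (css ! i)")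
      case True
      let ?N = "{p \<in> set (allowed css i). incident v p}"
      have "card ?N = card (set (filter (incident v) (allowed css i)))" by simp
      also have "\<dots> \<le> 4" using card_length four True that by (meson order_trans)
      finally have "card ?N \<le> 4" .
      moreover have "{p \<in> set (allowed css i) - P i. incident v p} = ?N - {p \<in> P i. incident v p}"
        by auto
      moreover have "card (?N - {p \<in> P i. incident v p}) = card ?N - card {p \<in> P i. incident v p}"
        using PA[OF that] by (intro card_Diff_subset) (auto simp: P_def)
      ultimately show ?thesis using deg[OF that, of v] True by simp
    next
      case False
      then have "{p \<in> set (allowed css i) - P i. incident v p} = {}"
        by (auto simp: allowed_def incident_def)
      then show ?thesis by (simp only: card.empty)
    qed
    show "\<forall>(p, i, j)\<in>set es. i < ?m \<and> j < ?m \<and> p \<in> set (allowed css i) \<and> p \<in> set (allowed css j) \<and>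
        (p \<in> P i \<longleftrightarrow> p \<notin> P j)"
    proof safe
      fix p1 p2 i j assume "((p1, p2), i, j) \<in> set es"
      then have o: "i < ?m" "j < ?m" "i \<noteq> j" "(p1, p2) \<in> set (allowed css i)"
          "(p1, p2) \<in> set (allowed css j)"
        "\<forall>k<?m. (p1, p2) \<in> set (allowed css k) \<longrightarrow> k = i \<or> k = j"
        using opts by auto
      show "i < ?m" "j < ?m" "(p1, p2) \<in> set (allowed css i)" "(p1, p2) \<in> set (allowed css j)"
        by fact+
      let ?p = "(p1, p2)"
      \<comment> \<open>Some inside cycle contains the edge by the covering property, and only
        \<open>i\<close> and \<open>j\<close> admit it. Disjointness of \<open>D i\<close> and
        \<open>D j\<close> makes it exactly one.\<close>
      have mem: "?p \<in> set (concat (map edge_list css))" using o(4) by (auto simp: allowed_def)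
      then have "edge_of ?p \<in> \<Union> Cs"
        unfolding Cs_def using cycle_edges_edge_list[OF len] by auto
      then have "edge_of ?p \<in> (\<Union>C\<in>Cs. f C)" by (simp only: cover)
      then obtain k where "k < ?m" "edge_of ?p \<in> D k"
        unfolding Cs_def D_def by (auto simp: in_set_conv_nth)
      then have "?p \<in> P k" "k = i \<or> k = j" using mem o(6) PA[of k] unfolding P_def by auto
      moreover have "D i \<inter> D j = {}"
      proof -
        \<comment> \<open>The chosen cycles are disjoint for different original cycles; different
          indices give different ones, being disjoint and nonempty.\<close>
        have "cycle_edges (css ! i) \<inter> cycle_edges (css ! j) = {}"
          by (rule packing_list_cycles_disjoint[OF css o(1-3)])
        moreover have "card (cycle_edges (css ! i)) = 8"
          using packing_cycles[OF _ pack C[OF o(1)]] card_8cycle by blast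
        ultimately have "cycle_edges (css ! i) \<noteq> cycle_edges (css ! j)" by force
        then show ?thesis unfolding D_def using f(2) C o(1,2) by blast
      qed
      ultimately show "?p \<in> P j \<Longrightarrow> ?p \<in> P i \<Longrightarrow> False" "?p \<notin> P j \<Longrightarrow> ?p \<in> P i"
        unfolding P_def by auto
    qed
  qed (simp_all add: consistent_def es)
  with es(2) show False by blast
qed

subsection \<open>Small orders\<close>

definition cycles_8 :: "nat list list" where
  "cycles_8 =
  [[0,3,1,2,4,7,5,6], [0,4,3,6,1,7,2,5], [0,2,6,4,1,5,3,7]]"

text \<open>Three cycles cover 24 of the 28 edges. By parity the remaining 4 form a
  1-factor.\<close>

lemma packing_8: "\<exists>Ds M. packing8 {..<8::nat} Ds M \<and> card M = 4"
proof -
  have "packing_list 8 cycles_8"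
    by (simp add: cycles_8_def packing_list_def edge_list_def sort_pair_def)
  note packing_list_packing8[OF this]
  then show ?thesis by (intro exI conjI) (simp_all add: cycles_8_def choose_two)
qed

definition cycles_10 :: "nat list list" where
  "cycles_10 =
  [[2,5,8,7,3,4,6,9], [0,6,1,7,5,9,4,8], [0,2,1,8,6,3,9,7], [0,4,2,8,3,5,1,9],
   [0,3,1,4,7,2,6,5]]"

lemma good_10: "good 10"
proof -
  \<comment> \<open>The search branches on 27 of the 40 covered edges, each with the indices of the
    two cycles that admit it; these already contradict each other in every branch.\<close>
  let ?es = "[((2,7),0,2), ((2,5),3,4), ((5,7),0,4), ((3,5),0,4), ((1,5),1,4), ((4,7),0,1),
   ((7,9),0,1), ((5,9),0,3), ((5,6),0,1), ((4,9),0,3), ((3,9),0,3), ((2,9),2,3),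
   ((2,6),0,2), ((2,8),0,2), ((2,4),0,4), ((4,8),0,3), ((6,8),0,1), ((3,6),0,4),
   ((3,8),0,2), ((3,4),3,4), ((7,8),1,2), ((5,8),1,3), ((3,7),2,4), ((1,8),1,3),
   ((1,4),1,3), ((1,2),3,4), ((1,7),2,4)] :: ((nat \<times> nat) \<times> nat \<times> nat) list"
  let ?Cs = "cycle_edges ` set cycles_10"
  have css: "packing_list 10 cycles_10"
    by (simp add: cycles_10_def packing_list_def edge_list_def sort_pair_def)
  have "\<not> almost_2_perfect8 {..<10} ?Cs (complete_edges {..<10} - \<Union> ?Cs)"
  proof (rule not_almost_2_perfect8_dead[OF css, of ?es])
    show "\<forall>i<length cycles_10. \<forall>v\<in>set (cycles_10 ! i).
        length (filter (incident v) (allowed cycles_10 i)) \<le> 4"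
      by code_simp
    show "\<forall>(p, i, j)\<in>set ?es. i < length cycles_10 \<and> j < length cycles_10 \<and> i \<noteq> j \<and>
        p \<in> set (allowed cycles_10 i) \<and> p \<in> set (allowed cycles_10 j) \<and>
        (\<forall>k<length cycles_10. p \<in> set (allowed cycles_10 k) \<longrightarrow> k = i \<or> k = j)"
      by code_simp
    show "distinct (map fst ?es)" by simp
    show "dead [] ?es" by code_simp
  qed
  moreover have "card (complete_edges {..<10} - \<Union> ?Cs) = 5"
    using packing_list_packing8(2)[OF css] by (simp add: cycles_10_def choose_two)
  ultimately show ?thesis
    unfolding good_def using packing_list_packing8(1)[OF css]
    by (intro exI[of _ ?Cs] exI[of _ "complete_edges {..<10} - \<Union> ?Cs"]) simp
qed

definition cycles_11 :: "nat list list" where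
  "cycles_11 =
  [[0,9,1,5,2,6,7,10], [0,6,3,5,7,9,10,8], [2,3,7,8,9,6,4,10], [1,7,4,9,3,10,5,8],
   [0,4,1,10,6,8,2,7], [1,3,8,4,2,9,5,6]]"

text \<open>The vertices 0 and 4 lie together on the fifth cycle only, where they are adjacent. The
  leave has 55 - 6 * 8 = 7 edges; the other orders are treated in the same way.\<close>

lemma good_11: "good 11"
  by (rule good_single_edge[of _ cycles_11 "(0, 4)" 7])
    (simp_all add: cycles_11_def packing_list_def single_edge_def edge_list_def sort_pair_def choose_two)

definition cycles_12 :: "nat list list" where
  "cycles_12 =
  [[3,5,4,11,8,9,7,10], [1,2,4,3,9,11,7,5], [2,5,6,10,11,3,7,8], [0,1,3,8,6,9,4,10],
   [0,7,6,2,11,5,10,8], [0,9,2,7,4,1,6,11], [2,3,6,4,8,5,9,10]]"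

lemma good_12: "good 12"
  by (rule good_single_edge[of _ cycles_12 "(1, 5)" 10])
    (simp_all add: cycles_12_def packing_list_def single_edge_def edge_list_def sort_pair_def choose_two)

definition cycles_13 :: "nat list list" where
  "cycles_13 =
  [[3,5,11,7,8,9,4,12], [0,11,3,1,4,5,7,12], [0,5,10,3,2,4,11,6], [1,6,9,2,8,12,11,10],
   [4,8,5,12,6,7,9,10], [1,9,11,8,3,6,2,12], [0,8,6,10,2,7,3,9], [1,7,10,12,9,5,2,11],
   [0,7,4,6,5,1,8,10]]"

lemma good_13: "good 13"
  by (rule good_single_edge[of _ cycles_13 "(0, 12)" 6])
    (simp_all add: cycles_13_def packing_list_def single_edge_def edge_list_def sort_pair_def choose_two)

definition cycles_14 :: "nat list list" where
  "cycles_14 =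
  [[0,7,3,11,9,12,10,8], [1,5,7,4,10,3,2,12], [2,5,11,13,6,7,10,9], [1,2,4,12,5,3,9,13],
   [2,6,3,13,5,9,4,8], [0,11,4,3,12,7,2,13], [6,9,7,11,10,13,8,12], [0,9,8,7,13,4,6,10],
   [0,1,4,5,8,6,11,12], [1,3,8,11,2,10,5,6]]"

lemma good_14: "good 14"
  by (rule good_single_edge[of _ cycles_14 "(1, 13)" 11])
    (simp_all add: cycles_14_def packing_list_def single_edge_def edge_list_def sort_pair_def choose_two)

definition cycles_15 :: "nat list list" where
  "cycles_15 =
  [[1,7,3,8,11,5,2,12], [1,6,4,11,13,9,2,14], [0,13,10,7,6,3,9,14], [2,8,13,5,9,6,11,10],
   [1,3,12,6,2,13,7,5], [0,9,7,4,2,11,1,10], [1,8,10,4,13,14,11,9], [3,5,10,9,12,8,4,14],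
   [3,10,6,8,5,14,12,13], [2,3,11,12,10,14,8,7], [0,7,14,6,13,1,4,12], [0,8,9,4,5,12,7,11]]"

lemma good_15: "good 15"
  by (rule good_single_edge[of _ cycles_15 "(0, 8)" 9])
    (simp_all add: cycles_15_def packing_list_def single_edge_def edge_list_def sort_pair_def choose_two)

definition cycles_16 :: "nat list list" where
  "cycles_16 =
  [[0,3,14,8,5,10,1,7], [0,11,2,4,8,12,10,13], [0,4,15,6,2,7,12,14], [2,10,9,6,11,8,15,13],
   [3,5,7,8,10,4,13,9], [1,11,3,7,14,10,6,13], [1,9,4,14,5,2,15,12], [0,10,7,15,11,9,5,12],
   [1,5,13,7,11,12,9,14], [1,3,12,6,5,11,13,8], [0,6,14,2,12,4,3,15], [0,5,15,1,6,4,7,9],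
   [0,2,9,15,10,3,6,8], [1,2,8,3,13,14,11,4]]"

lemma good_16: "good 16"
  by (rule good_single_edge[of _ cycles_16 "(0, 13)" 8])
    (simp_all add: cycles_16_def packing_list_def single_edge_def edge_list_def sort_pair_def choose_two)

definition cycles_17 :: "nat list list" where
  "cycles_17 =
  [[2,3,16,6,9,14,13,10], [5,6,11,8,10,7,9,12], [3,4,12,10,11,16,14,5],
   [1,8,13,11,7,4,6,14], [0,4,15,5,7,14,11,12], [0,5,1,7,2,14,10,16], [0,9,4,1,2,16,15,11],
   [0,2,13,6,15,1,16,7], [0,6,10,15,7,8,3,13], [2,12,14,8,6,7,3,15], [0,1,9,8,12,7,13,15],
   [1,10,5,16,9,11,3,12], [0,10,3,6,2,9,15,14], [2,4,14,3,9,13,5,11],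
   [1,11,4,5,8,15,12,13], [2,5,9,10,4,13,16,8], [0,3,1,6,12,16,4,8]]"

text \<open>The 17 cycles exhaust all 136 edges. They serve both as a base case and as the block
  added by \<open>good_add_16\<close>.\<close>

lemma packing_list_17: "packing_list 17 cycles_17"
  by (simp add: cycles_17_def packing_list_def edge_list_def sort_pair_def)

lemma good_17: "good 17"
  by (rule good_single_edge[OF packing_list_17, where p = "(5, 6)" and l = 0])
    (simp_all add: cycles_17_def single_edge_def edge_list_def sort_pair_def choose_two)

lemma packing_17: "\<exists>Ds. packing8 {..<17::nat} Ds {}"
proof -
  let ?Cs = "cycle_edges ` set cycles_17"
  let ?L = "complete_edges {..<17} - \<Union> ?Cs"
  have "length cycles_17 = 17" by (simp add: cycles_17_def)
  then have "card ?L = 0"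
    using packing_list_packing8(2)[OF packing_list_17] by (simp add: choose_two)
  moreover have "finite ?L" by (simp add: finite_complete_edges)
  ultimately have "?L = {}" by simp
  with packing_list_packing8(1)[OF packing_list_17] show ?thesis by metis
qed

definition cycles_19 :: "nat list list" where
  "cycles_19 =
  [[2,3,17,9,15,14,5,12], [0,9,18,6,17,4,12,10], [1,15,11,3,7,5,16,18],
   [0,5,9,12,16,7,1,8], [3,5,10,16,8,12,7,13], [0,11,6,12,13,17,7,18],
   [1,6,13,2,15,4,5,11], [4,6,10,14,16,11,8,13], [0,7,10,4,9,11,17,16],
   [2,4,7,6,9,13,5,18], [0,12,11,7,2,9,1,14], [1,5,2,6,15,3,4,16], [4,11,10,13,14,7,15,18],
   [0,13,15,16,6,14,2,17], [0,4,8,7,9,14,12,15], [1,4,14,3,9,10,8,17],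
   [3,6,8,9,16,13,18,12], [2,11,18,10,15,8,3,16], [0,3,1,10,17,15,5,6],
   [2,8,5,17,14,18,3,10], [1,12,17,18,8,14,11,13]]"

lemma good_19: "good 19"
  by (rule good_single_edge[of _ cycles_19 "(0, 3)" 3])
    (simp_all add: cycles_19_def packing_list_def single_edge_def edge_list_def sort_pair_def choose_two)

definition cycles_21 :: "nat list list" where
  "cycles_21 =
  [[4,6,14,17,18,13,10,16], [0,6,20,11,1,19,17,10], [1,4,15,20,10,12,11,7],
   [0,11,9,10,7,20,12,13], [0,15,16,9,7,4,2,17], [1,15,6,19,8,16,14,20],
   [1,6,13,4,9,5,11,18], [2,10,18,19,3,6,12,16], [4,5,14,12,17,20,8,10],
   [6,11,14,8,13,20,19,16], [2,6,10,14,15,8,17,11], [2,12,7,19,10,3,14,18],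
   [2,3,15,18,6,8,5,7], [0,12,5,10,11,8,7,14], [1,12,15,17,5,13,3,16],
   [0,9,17,7,16,18,4,19], [0,8,1,13,9,18,20,16], [4,8,9,6,17,16,13,14],
   [2,15,9,20,3,18,12,19], [1,5,3,7,13,19,15,10], [5,16,11,19,9,12,8,18],
   [0,18,7,15,13,11,4,20], [2,8,3,9,14,19,5,20], [1,9,2,5,15,11,3,17],
   [1,3,12,4,17,13,2,14]]"

lemma good_21: "good 21"
  by (rule good_single_edge[of _ cycles_21 "(0, 6)" 10])
    (simp_all add: cycles_21_def packing_list_def single_edge_def edge_list_def sort_pair_def choose_two)

definition cycles_23 :: "nat list list" where
  "cycles_23 =
  [[4,9,13,15,10,17,20,19], [0,15,12,14,19,10,9,21], [0,7,20,10,14,16,17,22],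
   [0,10,13,19,15,1,21,11], [5,19,6,18,8,13,12,21], [1,6,13,18,7,4,20,9],
   [2,6,9,15,22,8,19,16], [0,9,16,8,10,2,18,19], [2,12,10,18,22,11,6,21],
   [4,8,14,5,15,18,9,12], [3,9,5,12,18,14,20,11], [3,12,19,7,9,11,14,17],
   [1,11,17,15,2,13,20,18], [1,7,5,17,6,15,21,13], [0,6,7,10,22,19,17,8],
   [1,3,15,7,16,22,4,17], [3,10,21,16,20,15,11,13], [1,8,9,14,22,5,2,19],
   [4,11,10,6,5,18,17,13], [0,3,6,4,10,1,16,5], [1,4,18,21,17,9,2,20],
   [0,2,4,14,15,8,6,16], [3,8,20,6,22,7,13,14], [0,12,8,11,18,3,5,20],
   [1,5,4,15,16,3,21,14], [2,17,7,12,11,5,13,22], [0,13,16,10,5,8,7,14],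
   [2,7,3,22,9,19,21,8], [1,12,16,11,7,21,20,22], [2,11,19,3,20,12,6,14],
   [0,17,12,22,21,4,16,18]]"

lemma good_23: "good 23"
  by (rule good_single_edge[of _ cycles_23 "(4, 19)" 5])
    (simp_all add: cycles_23_def packing_list_def single_edge_def edge_list_def sort_pair_def choose_two)

definition cycles_25 :: "nat list list" where
  "cycles_25 =
  [[0,2,17,5,20,4,9,6], [0,4,5,19,13,22,1,24], [1,13,7,6,2,18,22,19],
   [0,9,8,14,16,12,5,21], [3,9,14,21,17,10,15,23], [3,14,18,10,19,6,21,22],
   [3,10,7,22,14,17,11,12], [0,10,20,19,11,6,5,16], [2,5,18,15,9,7,21,10],
   [3,4,24,16,23,17,9,5], [1,9,16,10,12,13,6,15], [1,7,20,17,4,13,18,16],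
   [0,14,11,18,7,23,5,22], [0,7,12,24,22,11,20,23], [1,11,8,10,9,20,16,21],
   [3,7,14,20,8,4,10,24], [1,3,19,8,21,9,22,23], [1,4,21,24,14,23,2,20],
   [2,9,23,4,7,17,13,11], [0,11,10,14,1,5,24,20], [2,4,15,3,16,17,8,13],
   [2,7,11,15,20,22,6,16], [9,12,14,13,10,23,18,19], [4,11,16,15,24,6,14,19],
   [6,8,16,19,7,15,21,20], [0,5,11,3,17,18,4,12], [2,14,4,16,7,5,13,24],
   [1,6,17,24,23,13,20,12], [1,10,22,12,23,11,9,18], [0,8,1,17,12,15,2,19],
   [2,8,15,17,22,4,6,12], [6,18,24,11,21,12,19,23], [3,18,12,8,24,9,13,21],
   [0,13,15,19,24,7,8,18], [2,21,18,20,3,13,16,22], [0,15,5,8,23,21,19,17],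
   [3,6,10,5,14,15,22,8]]"

lemma good_25: "good 25"
  by (rule good_single_edge[of _ cycles_25 "(2, 10)" 4])
    (simp_all add: cycles_25_def packing_list_def single_edge_def edge_list_def sort_pair_def choose_two)

section \<open>Induction on the order, in steps of 8 and 16\<close>

theorem mainTheorem2:
  fixes n :: nat
  assumes "n \<ge> 10"
  shows "\<exists>Cs L. max_packing8 {..<n} Cs L \<and> \<not> almost_2_perfect8 {..<n} Cs L"
proof -
  have "good n"
    using assms
  proof (induction n rule: less_induct)
    case (less n)
    show ?case
    proof (cases "even n")
      case True
      \<comment> \<open>From 18 on, \<open>n - 8\<close> is again an even order of at least
        10.\<close>
      then have "n = 10 \<or> n = 12 \<or> n = 14 \<or> n = 16 \<or> n \<ge> 18" using less.prems by presburger
      moreover have "good n" if "n \<ge> 18"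
      proof -
        obtain Ds M where "packing8 {..<8::nat} Ds M" "card M = 4" using packing_8 by blast
        then have "good (n - 8 + 8)"
          using that True by (intro good_add_8[of "n - 8"] less.IH) simp_all
        then show ?thesis using that by simp
      qed
      ultimately show ?thesis using good_10 good_12 good_14 good_16 by auto
    next
      case False
      \<comment> \<open>From 27 on, \<open>n - 16\<close> is again an odd order of at least
        11.\<close>
      then have "n = 11 \<or> n = 13 \<or> n = 15 \<or> n = 17 \<or> n = 19 \<or> n = 21 \<or> n = 23 \<or> n = 25 \<or> n \<ge> 27"
        using less.prems by presburger
      moreover have "good n" if "n \<ge> 27"
      proof -
        obtain Ds where "packing8 {..<17::nat} Ds {}" using packing_17 by blast
        then have "good (n - 16 + 16)"
          using that False by (intro good_add_16[of "n - 16"] less.IH) simp_all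
        then show ?thesis using that by simp
      qed
      ultimately show ?thesis
        using good_11 good_13 good_15 good_17 good_19 good_21 good_23 good_25 by auto
    qed
  qed
  then show ?thesis by (rule good_max_packing8)
qed

end
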